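(* Let $\sigma_2,\sigma_3,\ldots$ be chip configurations, $\sigma_n$ on $K_n$, with $0\le\sigma_n(v)\le n-1$ for all $v\in[n]$, and let $F:[0,1]\to[0,1]$ be continuous with $\frac1n\#\{v\in[n]:\sigma_n(v)<nx\}\to F(x)$ for every $x\in[0,1]$. Let $\Phi(x)=\lceil x\rceil-F(\lceil x\rceil-x)$, $\Phi_y(x)=\Phi(x)+y$, and suppose $(\bar\Phi_y)^q\ne\mathrm{Id}$ for all $y\in[0,1)$ and all $q\in\mathbb{N}$, where $\bar\Phi_y$ is the induced map of $\mathbb{R}/\mathbb{Z}$. Then for each $q\in\mathbb{N}$ there is a constant $c=c_q>0$ such that for all sufficiently large $n$, at least $cn$ of the states $\{\sigma_n+k\}_{k=0}^n$ have eventual period $q$.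
   Context: Parallel chip-firing on $K_n$: for $\sigma:[n]\to\mathbb{Z}_{\ge0}$, let $r(\sigma)=\#\{v:\sigma(v)\ge n\}$ and $U\sigma(v)=\sigma(v)+r(\sigma)$ if $\sigma(v)\le n-1$, $U\sigma(v)=\sigma(v)-n+r(\sigma)$ if $\sigma(v)\ge n$. $\sigma+k$ is the configuration obtained by adding $k$ chips to every vertex. The sequence $(U^t\sigma)_{t\ge0}$ is eventually periodic; the eventual period of $\sigma$ is the least $m\ge1$ such that $U^{t+m}\sigma=U^t\sigma$ for all sufficiently large $t$. *)

theory Defs
  imports "HOL-Analysis.Analysis"
begin

text \<open>
  Configurations on \<open>K\<^sub>n\<close> are functions \<open>nat \<Rightarrow> nat\<close> of which only the values on the vertex
  set \<open>[n] = {1..n}\<close> matter; configurations are therefore compared on \<open>{1..n}\<close> only.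
\<close>

definition unstable_count :: "nat \<Rightarrow> (nat \<Rightarrow> nat) \<Rightarrow> nat" where
  "unstable_count n \<sigma> = card {v \<in> {1..n}. \<sigma> v \<ge> n}"

definition chip_update :: "nat \<Rightarrow> (nat \<Rightarrow> nat) \<Rightarrow> (nat \<Rightarrow> nat)" where
  "chip_update n \<sigma> = (\<lambda>v. if \<sigma> v < n then \<sigma> v + unstable_count n \<sigma>
                          else \<sigma> v - n + unstable_count n \<sigma>)"

text \<open>
  The dynamics preserve the total number of chips, so there are only finitely many reachable
  states on \<open>{1..n}\<close> and the set of eventual periods below is never empty.
\<close>

definition eventual_period :: "nat \<Rightarrow> (nat \<Rightarrow> nat) \<Rightarrow> nat" where
  "eventual_period n \<sigma> =
     (LEAST m. m \<ge> 1 \<and>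
        (\<forall>\<^sub>F t in sequentially. \<forall>v\<in>{1..n}.
           (chip_update n ^^ (t + m)) \<sigma> v = (chip_update n ^^ t) \<sigma> v))"

definition add_chips :: "(nat \<Rightarrow> nat) \<Rightarrow> nat \<Rightarrow> (nat \<Rightarrow> nat)" where
  "add_chips \<sigma> k = (\<lambda>v. \<sigma> v + k)"

text \<open>Only the values of \<open>F\<close> on the unit interval enter here, as \<open>0 \<le> \<lceil>x\<rceil> - x < 1\<close>.\<close>

definition Phi :: "(real \<Rightarrow> real) \<Rightarrow> real \<Rightarrow> real" where
  "Phi F x = of_int \<lceil>x\<rceil> - F (of_int \<lceil>x\<rceil> - x)"

definition Phi_shift :: "(real \<Rightarrow> real) \<Rightarrow> real \<Rightarrow> real \<Rightarrow> real" where
  "Phi_shift F y x = Phi F x + y"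

lemma Phi_add_of_int: "Phi F (x + of_int k) = Phi F x + of_int k"
  by (simp add: Phi_def)

text \<open>The circle \<open>\<real>/\<int>\<close>, and the self-map of it induced by \<open>Phi_shift F y\<close>.\<close>

quotient_type circle = real / "\<lambda>x y :: real. x - y \<in> \<int>"
proof (rule equivpI)
  show "reflp (\<lambda>x y :: real. x - y \<in> \<int>)"
    by (rule reflpI) simp
  show "symp (\<lambda>x y :: real. x - y \<in> \<int>)"
    by (rule sympI) (metis Ints_minus minus_diff_eq)
  show "transp (\<lambda>x y :: real. x - y \<in> \<int>)"
  proof (rule transpI)
    fix x y z :: real
    assume "x - y \<in> \<int>" "y - z \<in> \<int>"
    then have "(x - y) + (y - z) \<in> \<int>" by (rule Ints_add)
    then show "x - z \<in> \<int>" by simp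
  qed
qed

lift_definition circle_map :: "(real \<Rightarrow> real) \<Rightarrow> real \<Rightarrow> circle \<Rightarrow> circle" is Phi_shift
proof -
  fix F :: "real \<Rightarrow> real" and y x x' :: real
  assume "x - x' \<in> \<int>"
  then obtain k where "x - x' = of_int k" by (auto elim: Ints_cases)
  then have "x = x' + of_int k" by simp
  then show "Phi_shift F y x - Phi_shift F y x' \<in> \<int>"
    by (simp add: Phi_shift_def Phi_add_of_int)
qed

end

theory Submission imports Defs begin

text \<open>
  Started from \<open>\<sigma> + k\<close>, the number of firings plus \<open>k\<close> evolves by iterating the monotone lift
  \<open>g m = (\<Sum>v. \<lfloor>(\<sigma> v + m) / n\<rfloor>) + k\<close>, which commutes with translation by \<open>n\<close>, and the eventual
  period of the configuration is that of the orbit modulo \<open>n\<close>. It equals \<open>q\<close> as soon as the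
  rotation number of \<open>g\<close> is \<open>p / q\<close> in lowest terms, which is certified by two points with
  \<open>g\<^sup>q m\<^sub>0 \<ge> m\<^sub>0 + n p\<close> and \<open>g\<^sup>q m\<^sub>1 \<le> m\<^sub>1 + n p\<close>. By Polya's theorem, \<open>g (n x) / n\<close> is uniformly close
  to \<open>\<Phi>\<^sub>y x\<close> for \<open>y = k / n\<close>; since \<open>\<Phi>\<^sub>y\<close> is monotone in \<open>x\<close> and \<open>y\<close>, an error \<open>\<epsilon>\<close> in the map is
  absorbed, for all iterates at once, by a shift of \<open>y\<close> by \<open>\<epsilon>\<close>. So it suffices to find \<open>a < b\<close> such
  that \<open>\<Phi>\<^sub>a\<^sup>q\<close> moves some point by more than \<open>p\<close> and \<open>\<Phi>\<^sub>b\<^sup>q\<close> moves some point by less than \<open>p\<close>. Take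
  \<open>p = 1\<close> for \<open>q \<ge> 2\<close>, and \<open>p = 0\<close> or \<open>p = 1\<close> for \<open>q = 1\<close>.
\<close>

section \<open>From chip configurations to a monotone lift on the integers\<close>

text \<open>The summand counts the firings of \<open>v\<close> up to and including the step at which
  \<open>v\<close>, starting from \<open>\<sigma> v\<close>, has received \<open>m\<close> chips in
  all. Integer arguments allow translation in both directions by multiples of
  \<open>n\<close>.\<close>

definition fire_lift :: "nat \<Rightarrow> (nat \<Rightarrow> nat) \<Rightarrow> int \<Rightarrow> int" where
  "fire_lift n \<sigma> m = (\<Sum>v\<in>{1..n}. (int (\<sigma> v) + m) div int n)"

lemma fire_lift_mono:
  assumes "m \<le> m'"
  shows "fire_lift n \<sigma> m \<le> fire_lift n \<sigma> m'"
  unfolding fire_lift_def using assms by (cases "n = 0") (auto intro!: sum_mono zdiv_mono1)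

lemma fire_lift_add_mult:
  assumes "n \<ge> 1"
  shows "fire_lift n \<sigma> (m + int n * j) = fire_lift n \<sigma> m + int n * j"
proof -
  have "(int (\<sigma> v) + (m + int n * j)) div int n = (int (\<sigma> v) + m) div int n + j" for v
    using assms div_mult_self2[of "int n" "int (\<sigma> v) + m" j] by (simp add: add.assoc)
  then show ?thesis
    by (simp add: fire_lift_def sum.distrib)
qed

lemma funpow_commute_add:
  fixes g :: "'a::plus \<Rightarrow> 'a"
  assumes "\<And>x. g (x + c) = g x + c"
  shows "(g ^^ t) (x + c) = (g ^^ t) x + c"
  by (induction t) (simp_all add: assms)

text \<open>The invariant behind the induction: \<open>u v\<close> is the number of firings of \<open>v\<close> so far, and
  \<open>\<beta> t - k\<close> is the total number of firings.\<close>

lemma chip_orbit: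
  assumes "n \<ge> 1" and conf: "\<And>v. v \<in> {1..n} \<Longrightarrow> \<sigma> v < n" and "k \<le> n"
    and \<beta>_def: "\<And>t. \<beta> t = ((\<lambda>m. fire_lift n \<sigma> m + int k) ^^ t) (int k)"
    and "v \<in> {1..n}"
  shows "int ((chip_update n ^^ Suc t) (add_chips \<sigma> k) v)
    = int (\<sigma> v) + \<beta> (Suc t) - int n * ((int (\<sigma> v) + \<beta> t) div int n)"
proof -
  define U where "U t = (chip_update n ^^ t) (add_chips \<sigma> k)" for t
  have \<beta>_Suc: "\<beta> (Suc t) = fire_lift n \<sigma> (\<beta> t) + int k" for t
    by (simp add: \<beta>_def)
  \<comment> \<open>The bound \<open>2 * n\<close> makes \<open>U t v div n\<close> equal to 0 or 1.
    It persists because firing brings a vertex below \<open>n\<close> and at most \<open>n\<close>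
    chips arrive per step.\<close>
  have step: "int (U (Suc t) v) = int (\<sigma> v) + \<beta> (Suc t) - int n * ((int (\<sigma> v) + \<beta> t) div int n)
      \<and> U (Suc t) v < 2 * n"
    if "v \<in> {1..n}" and sum_u: "(\<Sum>v\<in>{1..n}. u v) = \<beta> t - int k"
      and val: "\<And>v. v \<in> {1..n} \<Longrightarrow> int (U t v) = int (\<sigma> v) + \<beta> t - int n * u v"
      and small: "\<And>v. v \<in> {1..n} \<Longrightarrow> U t v < 2 * n" for u t v
  proof -
    have quot: "(int (\<sigma> v) + \<beta> t) div int n = u v + (if n \<le> U t v then 1 else 0)"
      if "v \<in> {1..n}" for v
    proof -
      have e: "int (\<sigma> v) + \<beta> t = int (U t v) + int n * u v"
        using val[OF that] by simp
      have "(int (\<sigma> v) + \<beta> t) div int n = u v + int (U t v) div int n"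
        using \<open>n \<ge> 1\<close> by (simp add: e)
      moreover have "U t v div n = (if n \<le> U t v then 1 else 0)"
        using small[OF that] \<open>n \<ge> 1\<close> by (auto simp: div_nat_eqI)
      ultimately show ?thesis
        by (auto simp flip: zdiv_int)
    qed
    have "fire_lift n \<sigma> (\<beta> t)
        = (\<Sum>v\<in>{1..n}. u v) + (\<Sum>v\<in>{1..n}. if n \<le> U t v then 1 else 0)"
      unfolding fire_lift_def sum.distrib[symmetric] by (intro sum.cong) (auto simp: quot)
    also have "(\<Sum>v\<in>{1..n}. if n \<le> U t v then 1 else (0::int)) = int (unstable_count n (U t))"
      by (simp add: unstable_count_def flip: sum.inter_filter)
    finally have r: "int (unstable_count n (U t)) = \<beta> (Suc t) - \<beta> t"
      using sum_u by (simp add: \<beta>_Suc)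
    have "unstable_count n (U t) \<le> card {1..n}"
      unfolding unstable_count_def by (rule card_mono) auto
    then have rn: "unstable_count n (U t) \<le> n"
      by simp
    have U_Suc: "U (Suc t) = chip_update n (U t)"
      by (simp add: U_def)
    have prod: "int n * ((int (\<sigma> v) + \<beta> t) div int n)
        = int n * u v + (if n \<le> U t v then int n else 0)"
      by (simp add: quot[OF that(1)] distrib_left)
    show ?thesis
    proof (cases "n \<le> U t v")
      case True
      then have Uv: "U (Suc t) v = U t v - n + unstable_count n (U t)"
        by (simp add: U_Suc chip_update_def)
      then have "int (U (Suc t) v) = int (U t v) - int n + int (unstable_count n (U t))"
        using True by simp
      then show ?thesis
        using True Uv rn small[OF that(1)] r val[OF that(1)] prod by auto
    next
      case False
      then have Uv: "U (Suc t) v = U t v + unstable_count n (U t)"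
        by (simp add: U_Suc chip_update_def)
      then have "int (U (Suc t) v) = int (U t v) + int (unstable_count n (U t))"
        by simp
      then show ?thesis
        using False Uv rn r val[OF that(1)] prod by auto
    qed
  qed
  have inv: "\<exists>u. (\<Sum>v\<in>{1..n}. u v) = \<beta> t - int k \<and>
      (\<forall>v\<in>{1..n}. int (U t v) = int (\<sigma> v) + \<beta> t - int n * u v \<and> U t v < 2 * n)" for t
  proof (induction t)
    case 0
    show ?case
      using conf \<open>k \<le> n\<close> by (intro exI[of _ "\<lambda>_. 0"]) (fastforce simp: \<beta>_def U_def add_chips_def)
  next
    case (Suc t)
    then obtain u where u: "(\<Sum>v\<in>{1..n}. u v) = \<beta> t - int k"
      "\<And>v. v \<in> {1..n} \<Longrightarrow> int (U t v) = int (\<sigma> v) + \<beta> t - int n * u v"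
      "\<And>v. v \<in> {1..n} \<Longrightarrow> U t v < 2 * n"
      by blast
    show ?case
      using step[OF _ u] by (intro exI[of _ "\<lambda>v. (int (\<sigma> v) + \<beta> t) div int n"])
        (simp add: \<beta>_Suc fire_lift_def)
  qed
  show ?thesis
    using inv[of t] step[OF \<open>v \<in> {1..n}\<close>, of _ t] by (auto simp: U_def)
qed

text \<open>A translation of \<open>\<beta>\<close> by \<open>n * p\<close> cancels against the
  quotient, so \<open>q\<close> is a period. Conversely, a period \<open>m\<close> moves
  \<open>\<beta>\<close> by some \<open>n * s\<close>; comparing \<open>q\<close> such moves with
  \<open>m\<close> moves by \<open>n * p\<close> gives \<open>q * s = m * p\<close>, and coprimality
  forces \<open>q\<close> to divide \<open>m\<close>.\<close>

lemma eventual_period_eqI: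
  assumes n: "n \<ge> 1" and conf: "\<And>v. v \<in> {1..n} \<Longrightarrow> \<sigma> v < n" and k: "k \<le> n"
    and g_def: "g = (\<lambda>m. fire_lift n \<sigma> m + int k)"
    and q: "q \<ge> 1" and coprime: "coprime p (int q)"
    and ev: "\<forall>\<^sub>F t in sequentially. (g ^^ (t + q)) (int k) = (g ^^ t) (int k) + int n * p"
  shows "eventual_period n (add_chips \<sigma> k) = q"
proof -
  define \<beta> where "\<beta> t = (g ^^ t) (int k)" for t
  let ?U = "\<lambda>t. (chip_update n ^^ t) (add_chips \<sigma> k)"
  have orbit: "int (?U (Suc t) v)
      = int (\<sigma> v) + \<beta> (Suc t) - int n * ((int (\<sigma> v) + \<beta> t) div int n)"
    if "v \<in> {1..n}" for t v
    by (rule chip_orbit[OF n conf k _ that]) (simp_all add: \<beta>_def g_def)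
  obtain T where T: "\<And>t. t \<ge> T \<Longrightarrow> \<beta> (t + q) = \<beta> t + int n * p"
    using ev unfolding \<beta>_def eventually_sequentially by blast
  have U_eq: "?U (Suc t + q) v = ?U (Suc t) v" if "t \<ge> T" "v \<in> {1..n}" for t v
  proof -
    have "int (?U (Suc t + q) v) = int (\<sigma> v) + \<beta> (Suc t + q)
        - int n * ((int (\<sigma> v) + \<beta> (t + q)) div int n)"
      using orbit[OF that(2), of "t + q"] by simp
    moreover have "(int (\<sigma> v) + (\<beta> t + int n * p)) div int n = (int (\<sigma> v) + \<beta> t) div int n + p"
      using n div_mult_self2[of "int n" "int (\<sigma> v) + \<beta> t" p] by (simp add: add.assoc)
    ultimately have "int (?U (Suc t + q) v) = int (?U (Suc t) v)"
      using T[of "Suc t"] T[of t] that(1) orbit[OF that(2), of t]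
      by (simp add: algebra_simps)
    then show ?thesis by linarith
  qed
  \<comment> \<open>The orbit formula describes configurations after at least one update, hence the
    threshold \<open>Suc T\<close>.\<close>
  have "?U (t + q) v = ?U t v" if "t \<ge> Suc T" "v \<in> {1..n}" for t v
    using U_eq[of "t - 1" v] that by (cases t) auto
  then have q_period: "1 \<le> q \<and> (\<forall>\<^sub>F t in sequentially. \<forall>v\<in>{1..n}. ?U (t + q) v = ?U t v)"
    using q unfolding eventually_sequentially by blast
  have q_least: "q \<le> m"
    if m: "1 \<le> m \<and> (\<forall>\<^sub>F t in sequentially. \<forall>v\<in>{1..n}. ?U (t + m) v = ?U t v)" for m
  proof -
    obtain T' where T': "\<And>t v. t \<ge> T' \<Longrightarrow> v \<in> {1..n} \<Longrightarrow> ?U (t + m) v = ?U t v"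
      using m unfolding eventually_sequentially by blast
    have g_add: "g (x + int n * j) = g x + int n * j" for x j
      using fire_lift_add_mult[OF n] by (simp add: g_def)
    define t where "t = Suc (T + T')"
    have one: "1 \<in> {1..n}" using n by simp
    \<comment> \<open>A single vertex determines \<open>\<beta>\<close> modulo \<open>n\<close>, so
      periodicity at vertex 1 is enough.\<close>
    have "?U (Suc (T + T' + m)) 1 = ?U (Suc (T + T')) 1"
      using T'[of "Suc (T + T')" 1] one by simp
    then obtain s where s: "\<beta> (t + m) = \<beta> t + int n * s"
      using orbit[OF one, of "T + T' + m"] orbit[OF one, of "T + T'"]
      by (intro that[of "(int (\<sigma> 1) + \<beta> (T + T' + m)) div int n - (int (\<sigma> 1) + \<beta> (T + T')) div int n"])
        (simp add: t_def algebra_simps)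
    have "\<beta> (t + j * m) = \<beta> t + int n * (int j * s)" for j
    proof (induction j)
      case (Suc j)
      have "\<beta> (t + Suc j * m) = (g ^^ (j * m)) (\<beta> (t + m))"
        by (simp add: \<beta>_def algebra_simps flip: funpow_add comp_apply[of "g ^^ _" "g ^^ _"])
      also have "\<dots> = (g ^^ (j * m)) (\<beta> t) + int n * s"
        unfolding s by (rule funpow_commute_add) (rule g_add)
      also have "(g ^^ (j * m)) (\<beta> t) = \<beta> (t + j * m)"
        by (simp add: \<beta>_def algebra_simps flip: funpow_add comp_apply[of "g ^^ _" "g ^^ _"])
      finally show ?case
        using Suc by (simp add: algebra_simps)
    qed simp
    moreover have "\<beta> (t + j * q) = \<beta> t + int n * (int j * p)" for j
    proof (induction j)
      case (Suc j)
      then show ?case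
        using T[of "t + j * q"] by (simp add: t_def algebra_simps)
    qed simp
    \<comment> \<open>\<open>\<beta> (t + q * m)\<close> is computed in two ways, with
      \<open>j = q\<close> and with \<open>j = m\<close>.\<close>
    ultimately have "int n * (int q * s) = int n * (int m * p)"
      by (metis add_left_cancel mult.commute)
    then have "int q * s = int m * p"
      using n by simp
    then have "int q dvd int m * p"
      by (metis dvd_triv_left)
    then have "int q dvd int m"
      using coprime by (simp add: coprime_commute coprime_dvd_mult_left_iff)
    then show "q \<le> m"
      using m by (auto dest: dvd_imp_le)
  qed
  show ?thesis
    unfolding eventual_period_def by (rule Least_equality, fact q_period) (rule q_least)
qed

section \<open>Monotone integer maps and rotation numbers\<close>

text \<open>The orbit is nondecreasing and cannot pass \<open>hi\<close>; each strict increase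
  lowers the natural number \<open>hi - x\<close>, so it stops.\<close>

lemma mono_orbit_up:
  fixes h :: "int \<Rightarrow> int"
  assumes "mono h" "h hi \<le> hi" "x \<le> hi" "x \<le> h x"
  shows "\<exists>t. h ((h ^^ t) x) = (h ^^ t) x"
  using assms(3,4)
proof (induction "nat (hi - x)" arbitrary: x rule: less_induct)
  case less
  show ?case
  proof (cases "h x = x")
    case True
    then show ?thesis by (intro exI[of _ 0]) simp
  next
    case False
    have "h x \<le> hi"
      using monoD[OF \<open>mono h\<close> less.prems(1)] \<open>h hi \<le> hi\<close> by linarith
    moreover have "h x \<le> h (h x)"
      using monoD[OF \<open>mono h\<close> less.prems(2)] .
    ultimately obtain t where "h ((h ^^ t) (h x)) = (h ^^ t) (h x)"
      using less.hyps[of "h x"] less.prems False by auto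
    then show ?thesis
      by (intro exI[of _ "Suc t"]) (simp add: funpow_swap1)
  qed
qed

text \<open>A decreasing orbit becomes an increasing one under conjugation by negation, with
  \<open>- lo\<close> as the upper barrier.\<close>

lemma mono_orbit_fixpoint:
  fixes h :: "int \<Rightarrow> int"
  assumes "mono h" "h hi \<le> hi" "x \<le> hi" "lo \<le> h lo" "lo \<le> x"
  shows "\<exists>t. h ((h ^^ t) x) = (h ^^ t) x"
proof (cases "x \<le> h x")
  case True
  then show ?thesis using assms mono_orbit_up by blast
next
  case False
  define h' where "h' = (\<lambda>y. - h (- y))"
  have pow: "(h' ^^ t) (- x) = - (h ^^ t) x" for t
    by (induction t) (simp_all add: h'_def)
  have "mono h'"
    using \<open>mono h\<close> by (auto simp: h'_def mono_def)
  then obtain t where "h' ((h' ^^ t) (- x)) = (h' ^^ t) (- x)"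
    using mono_orbit_up[of h' "- lo" "- x"] assms False by (auto simp: h'_def)
  then have "h ((h ^^ t) x) = (h ^^ t) x"
    unfolding pow by (simp add: h'_def)
  then show ?thesis ..
qed

text \<open>Points moved above and below \<open>x + n p\<close> pin the rotation number of the lift to \<open>p / q\<close>, so
  that every orbit of \<open>x \<mapsto> g\<^sup>q x - n p\<close> is bounded.\<close>

lemma eventual_period_of_pinned:
  assumes n: "n \<ge> 1" and conf: "\<And>v. v \<in> {1..n} \<Longrightarrow> \<sigma> v < n" and k: "k \<le> n"
    and g_def: "g = (\<lambda>m. fire_lift n \<sigma> m + int k)"
    and q: "q \<ge> 1" and coprime: "coprime p (int q)"
    and lo: "m0 + int n * p \<le> (g ^^ q) m0"
    and hi: "(g ^^ q) m1 \<le> m1 + int n * p"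
  shows "eventual_period n (add_chips \<sigma> k) = q"
proof (rule eventual_period_eqI[OF n conf k g_def q coprime])
  define h where "h x = (g ^^ q) x - int n * p" for x
  have "mono g"
    using fire_lift_mono by (auto simp: g_def mono_def)
  then have "mono h"
    by (intro monoI) (simp add: h_def funpow_mono)
  have g_add: "(g ^^ t) (x + int n * j) = (g ^^ t) x + int n * j" for x j t
    by (rule funpow_commute_add) (simp add: g_def fire_lift_add_mult[OF n])
  have h_add: "h (x + int n * j) = h x + int n * j" for x j
    by (simp add: h_def g_add)
  \<comment> \<open>Large enough that translating \<open>m0\<close> down and \<open>m1\<close> up by
    \<open>n * J\<close> encloses \<open>k\<close> between the two barriers.\<close>
  define J where "J = \<bar>int k - m0\<bar> + \<bar>int k - m1\<bar>"
  have "J \<le> int n * J"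
    using n by (auto simp: J_def intro!: mult_le_cancel_right1[THEN iffD2])
  moreover have "int k - m1 \<le> J" "m0 - int k \<le> J"
    by (auto simp: J_def)
  ultimately have "int k \<le> m1 + int n * J" "m0 + int n * (- J) \<le> int k"
    unfolding mult_minus_right by linarith+
  moreover have "h (m1 + int n * J) \<le> m1 + int n * J"
    using hi unfolding h_add by (simp add: h_def)
  moreover have "m0 + int n * (- J) \<le> h (m0 + int n * (- J))"
    using lo unfolding h_add by (simp add: h_def)
  ultimately obtain s where s: "h ((h ^^ s) (int k)) = (h ^^ s) (int k)"
    using mono_orbit_fixpoint[OF \<open>mono h\<close>] by blast
  have h_pow: "(g ^^ (q * t)) x = (h ^^ t) x + int n * (int t * p)" for t x
  proof (induction t)
    case (Suc t)
    have "(g ^^ (q * Suc t)) x = (g ^^ q) ((g ^^ (q * t)) x)"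
      by (simp add: funpow_add)
    also have "\<dots> = (g ^^ q) ((h ^^ t) x) + int n * (int t * p)"
      unfolding Suc by (rule g_add)
    also have "(g ^^ q) ((h ^^ t) x) = (h ^^ Suc t) x + int n * p"
      by (simp add: h_def[of "(h ^^ t) x"])
    finally show ?case
      by (simp add: algebra_simps)
  qed simp
  \<comment> \<open>A fixed point of \<open>h\<close> is a point that \<open>g ^^ q\<close> advances
    by exactly \<open>n * p\<close>, and this survives translation by multiples of
    \<open>n\<close>.\<close>
  have base: "(g ^^ q) ((g ^^ (q * s)) (int k)) = (g ^^ (q * s)) (int k) + int n * p"
    using s by (simp add: h_pow g_add) (simp add: h_def)
  have "(g ^^ (t + q)) (int k) = (g ^^ t) (int k) + int n * p" if "t \<ge> q * s" for t
  proof -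
    define d where "d = t - q * s"
    have t: "t = d + q * s"
      using that by (simp add: d_def)
    then have t': "t + q = d + (q + q * s)"
      by simp
    have "(g ^^ (t + q)) (int k) = (g ^^ d) ((g ^^ q) ((g ^^ (q * s)) (int k)))"
      unfolding t' by (simp only: funpow_add comp_apply)
    also have "\<dots> = (g ^^ t) (int k) + int n * p"
      unfolding base g_add by (simp add: t funpow_add)
    finally show ?thesis .
  qed
  then show "\<forall>\<^sub>F t in sequentially. (g ^^ (t + q)) (int k) = (g ^^ t) (int k) + int n * p"
    unfolding eventually_sequentially by blast
qed

section \<open>The limit maps on the circle and their lifts\<close>

lemma circle_map_pow:
  "(circle_map F y ^^ q) (abs_circle x) = abs_circle ((Phi_shift F y ^^ q) x)"
  by (induction q) (simp_all add: circle_map.abs_eq)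

lemma circle_map_pow_neq_idD:
  assumes "(circle_map F y ^^ q) \<noteq> id"
  obtains x where "(Phi_shift F y ^^ q) x - x \<notin> \<int>"
proof -
  obtain c where c: "(circle_map F y ^^ q) c \<noteq> c"
    using assms by (metis eq_id_iff)
  obtain x where "c = abs_circle x"
    by (metis Quotient3_abs_rep Quotient3_circle)
  with c have "(Phi_shift F y ^^ q) x - x \<notin> \<int>"
    by (simp add: circle_map_pow circle.abs_eq_iff)
  then show thesis by (rule that)
qed

text \<open>On each \<open>[j, j + 1]\<close> the map is \<open>j + 1 - F (j + 1 - x)\<close>. At
  \<open>x = j\<close> the ceiling jumps, but \<open>F 0 = 0\<close> and \<open>F 1 = 1\<close> make
  neighbouring formulas agree.\<close>

lemma continuous_on_Phi:
  assumes cont: "continuous_on {0..1} F" and "F 0 = 0" "F 1 = 1"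
  shows "continuous_on UNIV (Phi F)"
proof -
  have piece: "continuous_on {of_int j .. of_int j + 1} (Phi F)" for j :: int
  proof -
    have "Phi F x = of_int j + 1 - F (of_int j + 1 - x)" if "x \<in> {of_int j .. of_int j + 1}" for x
    proof (cases "x = of_int j")
      case True
      then show ?thesis using assms(2,3) by (simp add: Phi_def)
    next
      case False
      then have "\<lceil>x\<rceil> = j + 1"
        using that by (intro ceiling_unique) auto
      then show ?thesis by (simp add: Phi_def)
    qed
    moreover have "continuous_on {of_int j .. of_int j + 1} (\<lambda>x. of_int j + 1 - F (of_int j + 1 - x))"
      by (intro continuous_intros continuous_on_compose2[OF cont]) auto
    ultimately show ?thesis
      by (metis (no_types, lifting) continuous_on_cong)
  qed
  have "isCont (Phi F) x" for x
  proof -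
    define j where "j = \<lfloor>x\<rfloor>"
    \<comment> \<open>Two adjacent intervals are glued so that \<open>x\<close> is interior even
      when it is an integer.\<close>
    have "continuous_on ({of_int (j - 1) .. of_int (j - 1) + 1} \<union> {of_int j .. of_int j + 1}) (Phi F)"
      by (intro continuous_on_closed_Un piece) auto
    moreover have "{of_int (j - 1) .. of_int (j - 1) + 1} \<union> {of_int j .. of_int j + 1}
        = {of_int j - 1 .. of_int j + (1::real)}"
      by auto
    ultimately have "continuous_on {of_int j - 1 .. of_int j + 1} (Phi F)"
      by simp
    moreover have "x \<in> interior {of_int j - 1 .. of_int j + 1}"
      using of_int_floor_le[of x] floor_correct[of x] by (simp add: j_def) linarith
    ultimately show ?thesis
      by (rule continuous_on_interior)
  qed
  then show ?thesis
    by (simp add: continuous_on_eq_continuous_at)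
qed

text \<open>Within one ceiling value the two sign changes cancel. Across different ones, \<open>Phi
  F x \<le> \<lceil>x\<rceil> \<le> \<lceil>y\<rceil> - 1 \<le> Phi F y\<close>.\<close>

lemma mono_Phi:
  assumes "mono_on {0..1} F" and "F ` {0..1} \<subseteq> {0..1}"
  shows "mono (Phi F)"
proof (rule monoI)
  fix x y :: real
  assume "x \<le> y"
  have range: "of_int \<lceil>z\<rceil> - z \<in> {0..1}" for z :: real
    using ceiling_correct[of z] by auto
  show "Phi F x \<le> Phi F y"
  proof (cases "\<lceil>x\<rceil> = \<lceil>y\<rceil>")
    case True
    have "F (of_int \<lceil>y\<rceil> - y) \<le> F (of_int \<lceil>x\<rceil> - x)"
      using \<open>x \<le> y\<close> True by (intro mono_onD[OF assms(1)] range) auto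
    with True show ?thesis by (simp add: Phi_def)
  next
    case False
    then have "\<lceil>x\<rceil> + 1 \<le> \<lceil>y\<rceil>"
      using ceiling_mono[OF \<open>x \<le> y\<close>] by linarith
    then have "of_int \<lceil>x\<rceil> + 1 \<le> (of_int \<lceil>y\<rceil> :: real)"
      by linarith
    moreover have "0 \<le> F (of_int \<lceil>x\<rceil> - x)" "F (of_int \<lceil>y\<rceil> - y) \<le> 1"
      using range assms(2) by (auto simp: image_subset_iff)
    ultimately show ?thesis by (simp add: Phi_def)
  qed
qed

section \<open>Parameter intervals on which the rotation number is pinned\<close>

lemma continuous_on_Phi_shift_pow:
  assumes "continuous_on UNIV (Phi F)"
  shows "continuous_on UNIV (\<lambda>y. (Phi_shift F y ^^ q) x)"
  by (induction q)
    (auto simp: Phi_shift_def intro!: continuous_intros continuous_on_compose2[OF assms])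

text \<open>At the supremum \<open>s\<close> of the parameters whose \<open>q\<close>-th iterate stays below \<open>x + 1\<close>, the iterate
  still does so; it is below \<open>x + 1\<close> strictly somewhere because it is not the identity modulo 1,
  and this survives a small increase of the parameter.\<close>

lemma pinned_interval_ge2:
  assumes cont: "continuous_on UNIV (Phi F)" and mono: "mono (Phi F)" and zero: "Phi F 0 = 0"
    and no_id: "\<And>y. y \<in> {0..<1} \<Longrightarrow> (circle_map F y ^^ q) \<noteq> id"
    and "q \<ge> 2"
  obtains a b x0 x1 where "0 \<le> a" "a < b" "b \<le> 1"
    "x0 + 1 < (Phi_shift F a ^^ q) x0" "(Phi_shift F b ^^ q) x1 < x1 + 1"
proof -
  define G where "G y x = (Phi_shift F y ^^ q) x" for x y
  have G_cont: "continuous_on UNIV (\<lambda>y. G y x)" for x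
    unfolding G_def by (rule continuous_on_Phi_shift_pow[OF cont])
  define S where "S = {y \<in> {0..1}. \<forall>x. G y x \<le> x + 1}"
  have "S = {0..1} \<inter> (\<Inter>x. {y. G y x \<le> x + 1})"
    by (auto simp: S_def)
  moreover have "closed {y. G y x \<le> x + 1}" for x
    by (intro closed_Collect_le G_cont continuous_on_const)
  ultimately have "closed S"
    by (simp add: closed_INT closed_Int)
  have "Phi_shift F 0 = Phi F"
    by (simp add: Phi_shift_def fun_eq_iff)
  \<comment> \<open>At parameter 0 every integer is fixed, so by monotonicity no orbit crosses the
    next integer; this puts 0 into \<open>S\<close>.\<close>
  have "(Phi F ^^ t) x \<le> of_int \<lceil>x\<rceil>" for t x
  proof (induction t)
    case (Suc t)
    have "Phi F (of_int \<lceil>x\<rceil>) = of_int \<lceil>x\<rceil>"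
      using Phi_add_of_int[of F 0 "\<lceil>x\<rceil>"] zero by simp
    then show ?case
      using monoD[OF mono Suc] by simp
  qed simp
  then have "G 0 x \<le> x + 1" for x
    unfolding G_def \<open>Phi_shift F 0 = Phi F\<close>
    by (rule order_trans) (use ceiling_correct[of x] in linarith)
  then have "0 \<in> S"
    by (simp add: S_def)
  define s where "s = Sup S"
  have bdd: "bdd_above S"
    by (auto simp: S_def intro: bdd_aboveI[of _ 1])
  have "s \<in> S"
    unfolding s_def using \<open>0 \<in> S\<close> bdd \<open>closed S\<close> by (intro closed_contains_Sup) auto
  \<comment> \<open>At parameter 1 the point 0 moves by \<open>q \<ge> 2\<close>, so 1 is outside
    \<open>S\<close>. Hence \<open>s < 1\<close>, where \<open>no_id\<close> applies.\<close>
  have "(Phi_shift F 1 ^^ t) 0 = real t" for t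
  proof (induction t)
    case (Suc t)
    then show ?case
      using Phi_add_of_int[of F 0 "int t"] zero by (simp add: Phi_shift_def)
  qed simp
  then have "1 \<notin> S"
    using \<open>q \<ge> 2\<close> by (auto simp: S_def G_def intro!: exI[of _ 0])
  with \<open>s \<in> S\<close> have s: "0 \<le> s" "s < 1"
    by (auto simp: S_def order_less_le)
  obtain x1 where x1: "G s x1 - x1 \<notin> \<int>"
    using circle_map_pow_neq_idD[OF no_id, of s] s by (auto simp: G_def)
  have "G s x1 \<le> x1 + 1"
    using \<open>s \<in> S\<close> by (auto simp: S_def)
  moreover have "G s x1 \<noteq> x1 + 1"
    using x1 by auto
  ultimately have "G s x1 < x1 + 1"
    by simp
  moreover have "((\<lambda>y. G y x1) \<longlongrightarrow> G s x1) (at_right s)"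
    using G_cont[of x1] by (meson UNIV_I continuous_on_def tendsto_within_subset subset_UNIV)
  ultimately have "\<forall>\<^sub>F y in at_right s. G y x1 < x1 + 1"
    by (simp add: order_tendstoD)
  moreover have "\<forall>\<^sub>F y in at_right s. y \<in> {s<..<1}"
    using s by (intro eventually_at_right_real)
  ultimately have "\<forall>\<^sub>F y in at_right s. G y x1 < x1 + 1 \<and> y \<in> {s<..<1}"
    by (rule eventually_conj)
  then obtain b where b: "G b x1 < x1 + 1" "s < b" "b < 1"
    using eventually_happens[of _ "at_right s"] by (auto simp: trivial_limit_at_right_real)
  \<comment> \<open>Any parameter above \<open>s\<close> lies outside \<open>S\<close>, so some
    point moves by more than 1; choosing it below \<open>b\<close> leaves an interval.\<close>
  define a where "a = (s + b) / 2"
  have "a \<notin> S"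
    using cSup_upper[OF _ bdd, of a] b by (auto simp: a_def s_def)
  then obtain x0 where "x0 + 1 < G a x0"
    using s b by (auto simp: S_def a_def not_le)
  then show thesis
    using b s by (intro that[of a b x0 x1]) (auto simp: a_def G_def)
qed

text \<open>For \<open>q = 1\<close> one witness is 0, which \<open>Phi F\<close> fixes, and the
  other is a point \<open>x\<close> with \<open>Phi F x \<noteq> x\<close>. If \<open>x\<close>
  moves down, small parameters work with \<open>p = 0\<close>; if it moves up, parameters just below
  1 work with \<open>p = 1\<close>. Capping \<open>d\<close> at 1 keeps them in the unit
  interval.\<close>

lemma pinned_interval:
  assumes cont: "continuous_on UNIV (Phi F)" and mono: "mono (Phi F)" and zero: "Phi F 0 = 0"
    and no_id: "\<And>y. y \<in> {0..<1} \<Longrightarrow> (circle_map F y ^^ q) \<noteq> id"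
    and "q \<ge> 1"
  obtains p :: int and a b x0 x1 where "coprime p (int q)" "0 \<le> a" "a < b" "b \<le> 1"
    "x0 + of_int p < (Phi_shift F a ^^ q) x0" "(Phi_shift F b ^^ q) x1 < x1 + of_int p"
proof (cases "q = 1")
  case False
  then have "q \<ge> 2" using \<open>q \<ge> 1\<close> by simp
  then show thesis
    using pinned_interval_ge2[OF cont mono zero no_id] that[of 1] by auto
next
  case True
  obtain x where "Phi F x - x \<notin> \<int>"
    using circle_map_pow_neq_idD[OF no_id, of 0] True by (auto simp: Phi_shift_def)
  then have "Phi F x \<noteq> x"
    by auto
  then consider "Phi F x < x" | "x < Phi F x"
    by linarith
  then show thesis
  proof cases
    case 1
    define d where "d = min 1 (x - Phi F x)"
    have "0 < d" "d \<le> 1" "d \<le> x - Phi F x"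
      using 1 by (auto simp: d_def)
    then show thesis
      using True zero by (intro that[of 0 "d / 4" "d / 2" 0 x]) (auto simp: Phi_shift_def)
  next
    case 2
    define d where "d = min 1 (Phi F x - x)"
    have "0 < d" "d \<le> 1" "d \<le> Phi F x - x"
      using 2 by (auto simp: d_def)
    then show thesis
      using True zero by (intro that[of 1 "1 - d / 2" "1 - d / 4" x 0]) (auto simp: Phi_shift_def)
  qed
qed

section \<open>Uniform convergence and comparison of the lifts\<close>

text \<open>Monotonicity squeezes \<open>C n x\<close> between its values at neighbouring points of
  a finite grid. Convergence there costs \<open>\<epsilon> / 2\<close>, and uniform continuity of
  \<open>F\<close> the other half.\<close>

lemma mono_pointwise_imp_uniform:
  fixes C :: "nat \<Rightarrow> real \<Rightarrow> real"
  assumes mono: "\<And>n. mono (C n)" and cont: "continuous_on {0..1} F"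
    and lim: "\<And>x. x \<in> {0..1} \<Longrightarrow> (\<lambda>n. C n x) \<longlonglongrightarrow> F x" and "\<epsilon> > 0"
  shows "\<forall>\<^sub>F n in sequentially. \<forall>x\<in>{0..1}. \<bar>C n x - F x\<bar> \<le> \<epsilon>"
proof -
  have "uniformly_continuous_on {0..1} F"
    using cont by (rule compact_uniformly_continuous) simp
  then obtain \<delta> where \<delta>: "\<delta> > 0"
    "\<And>x x'. x \<in> {0..1} \<Longrightarrow> x' \<in> {0..1} \<Longrightarrow> dist x' x < \<delta> \<Longrightarrow> dist (F x') (F x) < \<epsilon> / 2"
    using \<open>\<epsilon> > 0\<close> unfolding uniformly_continuous_on_def by (meson half_gt_zero)
  obtain K :: nat where K: "K > 0" "1 / real K < \<delta>"
    using \<delta>(1) by (metis nat_approx_posE zero_less_Suc)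
  have "\<forall>\<^sub>F n in sequentially. \<bar>C n (real i / real K) - F (real i / real K)\<bar> < \<epsilon> / 2"
    if "i \<le> K" for i
    using tendstoD[OF lim[of "real i / real K"], of "\<epsilon> / 2"] that \<open>\<epsilon> > 0\<close> K(1)
    by (simp add: dist_real_def)
  then have "\<forall>\<^sub>F n in sequentially. \<forall>i\<in>{..K}.
      \<bar>C n (real i / real K) - F (real i / real K)\<bar> < \<epsilon> / 2"
    by (intro eventually_ball_finite) auto
  then show ?thesis
  proof eventually_elim
    case (elim n)
    show ?case
    proof
      fix x :: real
      assume x: "x \<in> {0..1}"
      define i where "i = nat \<lfloor>x * real K\<rfloor>"
      have "real i = of_int \<lfloor>x * real K\<rfloor>"
        using x by (simp add: i_def)
      then have i: "real i \<le> x * real K" "x * real K < real i + 1"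
        by linarith+
      have "x * real K \<le> real K"
        using x K(1) by (simp add: mult_left_le_one_le)
      then have "i \<le> K"
        using i(1) by linarith
      define l where "l = real i / real K"
      \<comment> \<open>The minimum keeps \<open>u\<close> in the unit interval when
        \<open>x = 1\<close>.\<close>
      define u where "u = real (min (Suc i) K) / real K"
      have l: "l \<in> {0..1}" "l \<le> x" "x - l < \<delta>"
        using i K \<open>i \<le> K\<close> by (auto simp: l_def field_simps)
      have u: "u \<in> {0..1}" "x \<le> u" "u - x < \<delta>"
        using i K x \<open>x * real K \<le> real K\<close> by (auto simp: u_def min_def field_simps split: if_splits)
      have "C n l \<le> C n x" "C n x \<le> C n u"
        using mono l(2) u(2) by (auto dest: monoD)
      moreover have "\<bar>C n l - F l\<bar> < \<epsilon> / 2" "\<bar>C n u - F u\<bar> < \<epsilon> / 2"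
        using elim \<open>i \<le> K\<close> unfolding l_def u_def by auto
      moreover have "\<bar>F l - F x\<bar> < \<epsilon> / 2" "\<bar>F u - F x\<bar> < \<epsilon> / 2"
        using \<delta>(2)[OF x l(1)] \<delta>(2)[OF x u(1)] l(2,3) u(2,3) by (auto simp: dist_real_def)
      ultimately show "\<bar>C n x - F x\<bar> \<le> \<epsilon>"
        by linarith
    qed
  qed
qed

text \<open>Translation by a multiple of \<open>n\<close> reduces \<open>m\<close> to
  \<open>0 < r \<le> n\<close>, the range that matches the ceiling in \<open>Phi\<close>. There each
  quotient is 0 or 1, and it vanishes exactly when \<open>\<sigma> v < n - r\<close>, so the sum is
  \<open>n\<close> minus a count of the kind that \<open>F\<close> approximates.\<close>

lemma fire_lift_approx:
  assumes n: "n \<ge> 1" and conf: "\<And>v. v \<in> {1..n} \<Longrightarrow> \<sigma> v < n"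
    and approx: "\<And>x. x \<in> {0..1} \<Longrightarrow>
      \<bar>real (card {v \<in> {1..n}. real (\<sigma> v) < real n * x}) / real n - F x\<bar> \<le> \<epsilon>"
  shows "\<bar>of_int (fire_lift n \<sigma> m) / real n - Phi F (of_int m / real n)\<bar> \<le> \<epsilon>"
proof -
  define j where "j = \<lceil>of_int m / real n\<rceil>"
  define r where "r = m - int n * (j - 1)"
  have j: "of_int m / real n \<le> of_int j" "of_int j - 1 < of_int m / real n"
    unfolding j_def using ceiling_correct[of "of_int m / real n"] by auto
  have "of_int m \<le> real n * of_int j" "real n * (of_int j - 1) < of_int m"
    using j n by (simp_all add: field_simps)
  then have "of_int m \<le> (of_int (int n * j) :: real)" "of_int (int n * (j - 1)) < (of_int m :: real)"
    by simp_all
  then have r: "0 < r" "r \<le> int n"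
    unfolding of_int_le_iff of_int_less_iff by (simp_all add: r_def algebra_simps)
  define x where "x = of_int j - of_int m / real n"
  have x: "x \<in> {0..1}"
    using j by (auto simp: x_def)
  have nx: "real n * x = of_int (int n - r)"
    using n by (simp add: x_def r_def field_simps)
  have div: "(int (\<sigma> v) + r) div int n = 1 - (if real (\<sigma> v) < real n * x then 1 else 0)"
    if "v \<in> {1..n}" for v
  proof -
    have "real (\<sigma> v) < real n * x \<longleftrightarrow> int (\<sigma> v) < int n - r"
      unfolding nx by (metis of_int_less_iff of_int_of_nat_eq)
    moreover have "int (\<sigma> v) < int n"
      using conf[OF that] by simp
    ultimately show ?thesis
      using r by (auto intro!: div_pos_pos_trivial int_div_pos_eq[of _ _ 1 "int (\<sigma> v) + r - int n"])
  qed
  have "fire_lift n \<sigma> r = (\<Sum>v\<in>{1..n}. 1 - (if real (\<sigma> v) < real n * x then 1 else 0))"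
    unfolding fire_lift_def by (intro sum.cong div) auto
  also have "\<dots> = int n - int (card {v \<in> {1..n}. real (\<sigma> v) < real n * x})"
    by (simp add: sum_subtractf flip: sum.inter_filter)
  finally have "fire_lift n \<sigma> r = int n - int (card {v \<in> {1..n}. real (\<sigma> v) < real n * x})" .
  moreover have "fire_lift n \<sigma> m = fire_lift n \<sigma> r + int n * (j - 1)"
    using fire_lift_add_mult[OF n, of \<sigma> r "j - 1"] by (simp add: r_def)
  ultimately have "fire_lift n \<sigma> m
      = int n * j - int (card {v \<in> {1..n}. real (\<sigma> v) < real n * x})"
    by (simp add: right_diff_distrib)
  then have "of_int (fire_lift n \<sigma> m)
      = real n * of_int j - real (card {v \<in> {1..n}. real (\<sigma> v) < real n * x})"
    by simp
  then have "of_int (fire_lift n \<sigma> m) / real n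
      = of_int j - real (card {v \<in> {1..n}. real (\<sigma> v) < real n * x}) / real n"
    using n by (simp add: diff_divide_distrib)
  moreover have "Phi F (of_int m / real n) = of_int j - F x"
    by (simp add: Phi_def j_def x_def)
  ultimately show ?thesis
    using approx[OF x] by (simp add: abs_minus_commute)
qed

text \<open>Monotonicity passes the one-step inequality through all iterates, so no error
  accumulates with \<open>t\<close>.\<close>

lemma Phi_shift_pow_le_lift:
  assumes "mono (Phi F)" and "\<And>m. Phi F (of_int m / N) + y \<le> of_int (g m) / N"
    and "x \<le> of_int m / N"
  shows "(Phi_shift F y ^^ t) x \<le> of_int ((g ^^ t) m) / N"
proof (induction t)
  case (Suc t)
  show ?case
    using monoD[OF assms(1) Suc] assms(2)[of "(g ^^ t) m"] by (simp add: Phi_shift_def)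
qed (use assms(3) in simp)

lemma lift_le_Phi_shift_pow:
  assumes "mono (Phi F)" and "\<And>m. of_int (g m) / N \<le> Phi F (of_int m / N) + y"
    and "of_int m / N \<le> x"
  shows "of_int ((g ^^ t) m) / N \<le> (Phi_shift F y ^^ t) x"
proof (induction t)
  case (Suc t)
  show ?case
    using monoD[OF assms(1) Suc] assms(2)[of "(g ^^ t) m"] by (simp add: Phi_shift_def)
qed (use assms(3) in simp)

lemma card_nat_between:
  assumes "0 \<le> a"
  shows "b - a - 1 \<le> real (card {k. a \<le> real k \<and> real k \<le> b})"
proof (cases "a \<le> b")
  case True
  have "{k. a \<le> real k \<and> real k \<le> b} = {nat \<lceil>a\<rceil>..nat \<lfloor>b\<rfloor>}"
    using assms True by (auto simp: nat_le_iff le_nat_iff ceiling_le_iff le_floor_iff)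
  moreover have "b - a - 1 \<le> real (nat \<lfloor>b\<rfloor> + 1 - nat \<lceil>a\<rceil>)"
    using assms True by linarith
  ultimately show ?thesis by simp
qed simp

section \<open>A window of values of \<open>k\<close> with length proportional to
  \<open>n\<close>\<close>

theorem theorem4p8:
  fixes \<sigma> :: "nat \<Rightarrow> nat \<Rightarrow> nat" and F :: "real \<Rightarrow> real"
  assumes confined: "\<And>n v. n \<ge> 2 \<Longrightarrow> v \<in> {1..n} \<Longrightarrow> \<sigma> n v \<le> n - 1"
    and F_range: "F ` {0..1} \<subseteq> {0..1}"
    and F_cont: "continuous_on {0..1} F"
    and limit: "\<And>x. x \<in> {0..1} \<Longrightarrow>
      (\<lambda>n. real (card {v \<in> {1..n}. real (\<sigma> n v) < real n * x}) / real n) \<longlonglongrightarrow> F x"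
    and no_iterate_id: "\<And>y q. y \<in> {0..<1} \<Longrightarrow> q \<ge> 1 \<Longrightarrow> (circle_map F y ^^ q) \<noteq> id"
  shows "\<forall>q\<ge>1. \<exists>c>0. \<forall>\<^sub>F n in sequentially.
    real (card {k \<in> {0..n}. eventual_period n (add_chips (\<sigma> n) k) = q}) \<ge> c * real n"
proof (intro allI impI)
  fix q :: nat
  assume q: "q \<ge> 1"
  define C where "C n x = real (card {v \<in> {1..n}. real (\<sigma> n v) < real n * x}) / real n" for n x
  have C_mono: "mono (C n)" for n
    unfolding C_def
    by (intro monoI divide_right_mono of_nat_mono card_mono)
      (auto intro: less_le_trans mult_left_mono)
  have C_lim: "(\<lambda>n. C n x) \<longlonglongrightarrow> F x" if "x \<in> {0..1}" for x
    unfolding C_def using limit[OF that] .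
  have "F 0 = 0"
    using LIMSEQ_unique[OF C_lim[of 0]] by (simp add: C_def)
  have conf: "\<sigma> n v < n" if "n \<ge> 2" "v \<in> {1..n}" for n v
    using confined[OF that] that by simp
  have "C n 1 = 1" if "n \<ge> 2" for n
  proof -
    have "{v \<in> {1..n}. real (\<sigma> n v) < real n * 1} = {1..n}"
      using conf[OF that] by auto
    then show ?thesis using that by (simp add: C_def)
  qed
  then have "\<forall>\<^sub>F n in sequentially. C n 1 = 1"
    by (auto simp: eventually_sequentially)
  then have "F 1 = 1"
    using LIMSEQ_unique[OF C_lim[of 1] tendsto_eventually] by simp
  have F_mono: "mono_on {0..1} F"
    by (intro mono_onI LIMSEQ_le[OF C_lim C_lim]) (use C_mono in \<open>auto dest: monoD\<close>)
  note Phi_cont = continuous_on_Phi[OF F_cont \<open>F 0 = 0\<close> \<open>F 1 = 1\<close>]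
  note Phi_mono = mono_Phi[OF F_mono F_range]
  have "Phi F 0 = 0"
    by (simp add: Phi_def \<open>F 0 = 0\<close>)
  then obtain p :: int and a b x0 x1 where coprime: "coprime p (int q)"
    and ab: "0 \<le> a" "a < b" "b \<le> 1"
    and x0: "x0 + of_int p < (Phi_shift F a ^^ q) x0"
    and x1: "(Phi_shift F b ^^ q) x1 < x1 + of_int p"
    using pinned_interval[OF Phi_cont Phi_mono _ no_iterate_id q] q by metis
  \<comment> \<open>For \<open>k / n\<close> in \<open>[a + \<epsilon>, b - \<epsilon>]\<close>, an
    approximation error \<open>\<epsilon>\<close> keeps the lift between the maps with parameters
    \<open>a\<close> and \<open>b\<close>; this window still has length
    \<open>2 * \<epsilon>\<close>.\<close>
  define \<epsilon> where "\<epsilon> = (b - a) / 4"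
  have "\<epsilon> > 0" using ab by (simp add: \<epsilon>_def)
  \<comment> \<open>The slack in both displacements, which absorbs the rounding error
    \<open>1 / n\<close> of the witnesses. The cap at \<open>\<epsilon>\<close> later yields
    \<open>1 \<le> \<epsilon> * n\<close>.\<close>
  define \<eta> where "\<eta> = min ((Phi_shift F a ^^ q) x0 - x0 - of_int p)
    (min (x1 + of_int p - (Phi_shift F b ^^ q) x1) \<epsilon>)"
  have "\<eta> > 0" using x0 x1 \<open>\<epsilon> > 0\<close> by (simp add: \<eta>_def)
  have \<eta>: "x0 + of_int p + \<eta> \<le> (Phi_shift F a ^^ q) x0"
    "(Phi_shift F b ^^ q) x1 \<le> x1 + of_int p - \<eta>" "\<eta> \<le> \<epsilon>"
    unfolding \<eta>_def by linarith+
  have "\<forall>\<^sub>F n in sequentially. 1 / \<eta> \<le> real n"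
    using filterlim_real_sequentially by (simp add: filterlim_at_top)
  moreover have "\<forall>\<^sub>F n in sequentially. \<forall>x\<in>{0..1}. \<bar>C n x - F x\<bar> \<le> \<epsilon>"
    by (rule mono_pointwise_imp_uniform[OF C_mono F_cont C_lim \<open>\<epsilon> > 0\<close>])
  ultimately have "\<forall>\<^sub>F n in sequentially.
    real (card {k \<in> {0..n}. eventual_period n (add_chips (\<sigma> n) k) = q}) \<ge> \<epsilon> * real n"
    using eventually_ge_at_top[of 2]
  proof eventually_elim
    case (elim n)
    have "n \<ge> 1" and n: "real n > 0" using elim(3) by auto
    have inv_n: "1 / real n \<le> \<eta>"
      using elim(1) \<open>\<eta> > 0\<close> n by (simp add: field_simps)
    have "eventual_period n (add_chips (\<sigma> n) k) = q" "k \<le> n"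
      if k: "real n * (a + \<epsilon>) \<le> real k" "real k \<le> real n * (b - \<epsilon>)" for k
    proof -
      have k': "a + \<epsilon> \<le> real k / real n" "real k / real n \<le> b - \<epsilon>"
        using k n by (simp_all add: field_simps)
      then have "real k / real n \<le> 1"
        using ab \<open>\<epsilon> > 0\<close> by linarith
      then show "k \<le> n"
        using n by simp
      define g where "g = (\<lambda>m. fire_lift n (\<sigma> n) m + int k)"
      have "\<bar>of_int (fire_lift n (\<sigma> n) m) / real n - Phi F (of_int m / real n)\<bar> \<le> \<epsilon>" for m
        using elim(2,3) conf by (intro fire_lift_approx) (auto simp: C_def)
      note approx = this[unfolded abs_le_iff]
      have g_eq: "of_int (g m) / real n = of_int (fire_lift n (\<sigma> n) m) / real n + real k / real n" for m
        by (simp add: g_def add_divide_distrib)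
      have lo: "Phi F (of_int m / real n) + a \<le> of_int (g m) / real n" for m
        using approx[of m] k' unfolding g_eq by linarith
      have hi: "of_int (g m) / real n \<le> Phi F (of_int m / real n) + b" for m
        using approx[of m] k' unfolding g_eq by linarith
      have frac: "of_int (m + int n * p) / real n = of_int m / real n + of_int p" for m
        using n by (simp add: field_simps)
      have cancel: "of_int x / real n \<le> of_int y / real n \<longleftrightarrow> x \<le> y" for x y
        using n by (simp add: divide_le_cancel)
      \<comment> \<open>Rounding \<open>x0\<close> up and \<open>x1\<close> down is what the two
        comparison lemmas require; the displacements lose at most \<open>1 / n\<close>.\<close>
      define m0 where "m0 = \<lceil>real n * x0\<rceil>"
      define m1 where "m1 = \<lfloor>real n * x1\<rfloor>"
      have "real n * x0 \<le> of_int m0" "of_int m0 \<le> real n * x0 + 1"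
        "of_int m1 \<le> real n * x1" "real n * x1 \<le> of_int m1 + 1"
        unfolding m0_def m1_def by linarith+
      then have m: "x0 \<le> of_int m0 / real n" "of_int m0 / real n \<le> x0 + 1 / real n"
        "of_int m1 / real n \<le> x1" "x1 \<le> of_int m1 / real n + 1 / real n"
        using n by (simp_all add: field_simps)
      have "of_int m0 / real n + of_int p \<le> of_int ((g ^^ q) m0) / real n"
        using Phi_shift_pow_le_lift[where g = g and t = q, OF Phi_mono lo m(1)] m(2) inv_n \<eta>(1) by linarith
      then have "m0 + int n * p \<le> (g ^^ q) m0"
        unfolding frac[symmetric] cancel .
      moreover have "of_int ((g ^^ q) m1) / real n \<le> of_int m1 / real n + of_int p"
        using lift_le_Phi_shift_pow[where g = g and t = q, OF Phi_mono hi m(3)] m(4) inv_n \<eta>(2) by linarith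
      then have "(g ^^ q) m1 \<le> m1 + int n * p"
        unfolding frac[symmetric] cancel .
      ultimately show "eventual_period n (add_chips (\<sigma> n) k) = q"
        by (intro eventual_period_of_pinned[OF \<open>n \<ge> 1\<close> conf[OF elim(3)] \<open>k \<le> n\<close> g_def q coprime])
    qed
    then have "card {k. real n * (a + \<epsilon>) \<le> real k \<and> real k \<le> real n * (b - \<epsilon>)}
        \<le> card {k \<in> {0..n}. eventual_period n (add_chips (\<sigma> n) k) = q}"
      by (intro card_mono) auto
    moreover have "real n * (b - \<epsilon>) - real n * (a + \<epsilon>) - 1
        \<le> real (card {k. real n * (a + \<epsilon>) \<le> real k \<and> real k \<le> real n * (b - \<epsilon>)})"
      using ab \<open>\<epsilon> > 0\<close> by (intro card_nat_between) simp
    moreover have "real n * (b - \<epsilon>) - real n * (a + \<epsilon>) = 2 * (\<epsilon> * real n)"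
      by (simp add: \<epsilon>_def field_simps)
    \<comment> \<open>This pays for the 1 lost in counting the integers of the window, leaving at
      least \<open>\<epsilon> * n\<close> of them.\<close>
    moreover have "1 \<le> \<epsilon> * real n"
    proof -
      have "1 \<le> \<eta> * real n"
        using inv_n n by (simp add: field_simps)
      also have "\<dots> \<le> \<epsilon> * real n"
        using \<eta>(3) by (intro mult_right_mono) simp_all
      finally show ?thesis .
    qed
    ultimately show ?case
      by linarith
  qed
  with \<open>\<epsilon> > 0\<close> show "\<exists>c>0. \<forall>\<^sub>F n in sequentially.
      real (card {k \<in> {0..n}. eventual_period n (add_chips (\<sigma> n) k) = q}) \<ge> c * real n"
    by blast
qed

end
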